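(* Let $c_1,C_1,c''>0$ be constants. There exist constants $c,c',C,\tilde c>0$, depending only on $c_1,C_1,c''$, such that the following holds. Let $\alpha,M>0$ with $\alpha M^2\ge c''$. Let $Z_1,\dots,Z_k$ be centered independent real random variables whose moment generating functions satisfy $$\exp(c_1\alpha t^2)\le\phi_{Z_i}(t)\le\exp(C_1\alpha t^2),\qquad\forall\,|t|\le M,\ 1\le i\le k.$$ Let $u_1,\dots,u_k\ge0$, not all zero, and $X=u_1Z_1+\cdots+u_kZ_k$. Then $$c\exp\left(-C\frac{x^2}{\alpha\|u\|_2^2}\right)\le\mathbb{P}(X\ge x)\le\exp\left(-\tilde c\frac{x^2}{\alpha\|u\|_2^2}\right),\qquad\forall\,0\le x\le\frac{c'M\alpha\|u\|_2^2}{\|u\|_\infty}.$$ In addition, with the same $c'$ and $\tilde c$: for any constants $c_0,C_0,c_2>0$ there exist constants $\bar c,\bar C>0$, depending only on $c_1,C_1,c'',c_0,C_0,c_2$, such that if $\alpha,M>0$ satisfy $\alpha M^2\ge c''$, if $Z_1,\dots,Z_k$ are centered independent real random variables with $\exp(c_1\alpha t^2)\le\phi_{Z_i}(t)\le\exp(C_1\alpha t^2)$ for all $|t|\le M$ and $1\le i\le k$, if $u_1,\dots,u_k\ge0$ are not all zero and $X=u_1Z_1+\cdots+u_kZ_k$, and if there exists an index $i\in\{1,\dots,k\}$ with $$\mathbb{P}(Z_i\ge x)\ge c_0\exp(-C_0Mx),\qquad\forall\,x\ge2c'M\alpha,$$ and $u_i\ge c_2\|u\|_\infty$, then $$\bar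 c\exp\left(-\bar C\frac{Mx}{\|u\|_\infty}\right)\le\mathbb{P}(X\ge x)\le\exp\left(-\tilde c\frac{Mx}{\|u\|_\infty}\right),\qquad\forall\,x\ge\frac{c'M\alpha\|u\|_2^2}{\|u\|_\infty}.$$
   Context: A random variable is centered if its expectation is $0$. $\phi_Z(t)=\mathbb{E}\exp(tZ)$ is the moment generating function of $Z$. For $u\in\mathbb{R}^k$, $\|u\|_2=(\sum_iu_i^2)^{1/2}$ and $\|u\|_\infty=\max_i|u_i|$. *)

theory Defs
  imports "HOL-Probability.Probability"
begin

definition centered :: "'a measure \<Rightarrow> ('a \<Rightarrow> real) \<Rightarrow> bool" where
  "centered \<Omega> Z \<longleftrightarrow> integrable \<Omega> Z \<and> integral\<^sup>L \<Omega> Z = 0"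

text \<open>The Bochner integral of a non-integrable function is \<open>0\<close>. Where \<open>mgf \<Omega> Z t\<close> is bounded below by a
  positive number, as in \<open>mgf_setting\<close> below, the moment generating function is therefore finite
  at \<open>t\<close>.\<close>

definition mgf :: "'a measure \<Rightarrow> ('a \<Rightarrow> real) \<Rightarrow> real \<Rightarrow> real" where
  "mgf \<Omega> Z t = (\<integral>\<omega>. exp (t * Z \<omega>) \<partial>\<Omega>)"

definition sup_norm :: "nat \<Rightarrow> (nat \<Rightarrow> real) \<Rightarrow> real" where
  "sup_norm k u = Max ((\<lambda>i. \<bar>u i\<bar>) ` {1..k})"

definition weighted_sum :: "nat \<Rightarrow> (nat \<Rightarrow> real) \<Rightarrow> (nat \<Rightarrow> 'a \<Rightarrow> real) \<Rightarrow> 'a \<Rightarrow> real" where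
  "weighted_sum k u Z \<omega> = (\<Sum>i=1..k. u i * Z i \<omega>)"

text \<open>Families and weight vectors are indexed by \<open>{1..k}\<close>; their values at other indices are irrelevant.
  The predicate \<open>indep_vars\<close> includes measurability of the \<open>Z i\<close>, and \<open>k \<ge> 1\<close> follows from the
  existence of a nonzero weight.\<close>

definition mgf_setting ::
  "'a measure \<Rightarrow> nat \<Rightarrow> (nat \<Rightarrow> 'a \<Rightarrow> real) \<Rightarrow> (nat \<Rightarrow> real) \<Rightarrow> real \<Rightarrow> real \<Rightarrow> real \<Rightarrow> real \<Rightarrow> real \<Rightarrow> bool"
where
  "mgf_setting \<Omega> k Z u c1 C1 c'' \<alpha> M \<longleftrightarrow>
     0 < \<alpha> \<and> 0 < M \<and> c'' \<le> \<alpha> * M\<^sup>2 \<and>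
     prob_space \<Omega> \<and>
     prob_space.indep_vars \<Omega> (\<lambda>_. borel) Z {1..k} \<and>
     (\<forall>i\<in>{1..k}. centered \<Omega> (Z i)) \<and>
     (\<forall>i\<in>{1..k}. \<forall>t. \<bar>t\<bar> \<le> M \<longrightarrow>
        exp (c1 * \<alpha> * t\<^sup>2) \<le> mgf \<Omega> (Z i) t \<and> mgf \<Omega> (Z i) t \<le> exp (C1 * \<alpha> * t\<^sup>2)) \<and>
     (\<forall>i\<in>{1..k}. 0 \<le> u i) \<and> (\<exists>i\<in>{1..k}. u i \<noteq> 0)"

text \<open>A formula cannot quantify over the type of the sample space, so the two predicates below take
  that type as an argument. Constants may be chosen independently of the sample space by choosing
  them for \<open>TYPE(nat \<Rightarrow> real)\<close>, the type on which the joint law of \<open>Z 1, \<dots>, Z k\<close> lives, and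
  then requiring that the chosen constants also work for \<open>TYPE('a)\<close> with \<open>'a\<close> arbitrary. An
  existential statement about \<open>TYPE('a)\<close> alone would let the constants depend on \<open>'a\<close>.\<close>

definition central_tail_bounds ::
  "'a itself \<Rightarrow> real \<Rightarrow> real \<Rightarrow> real \<Rightarrow> real \<Rightarrow> real \<Rightarrow> real \<Rightarrow> real \<Rightarrow> bool"
where
  "central_tail_bounds T c1 C1 c'' c c' C c_tilde \<longleftrightarrow>
     (\<forall>(\<Omega> :: 'a measure) k Z u \<alpha> M. mgf_setting \<Omega> k Z u c1 C1 c'' \<alpha> M \<longrightarrow>
       (\<forall>x. 0 \<le> x \<and> x \<le> c' * M * \<alpha> * (L2_set u {1..k})\<^sup>2 / sup_norm k u \<longrightarrow>
         c * exp (- C * (x\<^sup>2 / (\<alpha> * (L2_set u {1..k})\<^sup>2))) \<le> \<P>(\<omega> in \<Omega>. weighted_sum k u Z \<omega> \<ge> x) \<and>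
         \<P>(\<omega> in \<Omega>. weighted_sum k u Z \<omega> \<ge> x) \<le> exp (- c_tilde * (x\<^sup>2 / (\<alpha> * (L2_set u {1..k})\<^sup>2)))))"

definition far_tail_bounds ::
  "'a itself \<Rightarrow> real \<Rightarrow> real \<Rightarrow> real \<Rightarrow> real \<Rightarrow> real \<Rightarrow> real \<Rightarrow> real \<Rightarrow> real \<Rightarrow> real \<Rightarrow> real \<Rightarrow> bool"
where
  "far_tail_bounds T c1 C1 c'' c' c_tilde c0 C0 c2 c_bar C_bar \<longleftrightarrow>
     (\<forall>(\<Omega> :: 'a measure) k Z u \<alpha> M. mgf_setting \<Omega> k Z u c1 C1 c'' \<alpha> M \<and>
       (\<exists>i\<in>{1..k}. (\<forall>x. 2 * c' * M * \<alpha> \<le> x \<longrightarrow> c0 * exp (- C0 * M * x) \<le> \<P>(\<omega> in \<Omega>. Z i \<omega> \<ge> x)) \<and>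
          c2 * sup_norm k u \<le> u i) \<longrightarrow>
       (\<forall>x. c' * M * \<alpha> * (L2_set u {1..k})\<^sup>2 / sup_norm k u \<le> x \<longrightarrow>
         c_bar * exp (- C_bar * (M * x / sup_norm k u)) \<le> \<P>(\<omega> in \<Omega>. weighted_sum k u Z \<omega> \<ge> x) \<and>
         \<P>(\<omega> in \<Omega>. weighted_sum k u Z \<omega> \<ge> x) \<le> exp (- c_tilde * (M * x / sup_norm k u))))"

end

theory Submission
  imports Defs
begin

text \<open>
  Put \<open>s = \<alpha> \<parallel>u\<parallel>\<^sub>2\<^sup>2\<close> and \<open>R = M / \<parallel>u\<parallel>\<^sub>\<infinity>\<close>. By independence the moment generating
  functions of the summands multiply, so \<open>exp (c1 s t\<^sup>2) \<le> \<phi>\<^sub>X(t) \<le> exp (C1 s t\<^sup>2)\<close> for \<open>\<bar>t\<bar> \<le> R\<close>,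
  and \<open>s R\<^sup>2 \<ge> \<alpha> M\<^sup>2 \<ge> c''\<close> because \<open>\<parallel>u\<parallel>\<^sub>\<infinity> \<le> \<parallel>u\<parallel>\<^sub>2\<close> (\<open>mgf_setting_consequences\<close>).
  All bounds except the lower one in the far range follow from these facts about the single variable \<open>X\<close>.

  Both upper bounds are Markov's inequality for \<open>exp (t X)\<close>: in the central range with the optimal
  \<open>t\<close>, in the far range, where the optimal \<open>t\<close> may exceed \<open>R\<close>, with a fixed fraction of \<open>R\<close>.

  The central lower bound is the Paley--Zygmund inequality for \<open>exp (t X)\<close>, whose second moment is
  \<open>\<phi>\<^sub>X(2 t)\<close> (\<open>mgf_sandwich_lower_tail\<close>). It is at least the fraction \<open>exp (- c1 s t\<^sup>2 / 2)\<close> of its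
  mean only where \<open>X \<ge> c1 s t / 2\<close>, which is \<open>x\<close> for \<open>t = 2 x / (c1 s)\<close>, and the probability of this is at least
  \<open>(1 - exp (- c1 s t\<^sup>2 / 2))\<^sup>2 exp (- 4 C1 s t\<^sup>2)\<close>. Letting the fraction depend on \<open>t\<close> makes this positive
  for every \<open>t > 0\<close>, however small, which matters as \<open>R \<surd>s\<close> is bounded below only by \<open>\<surd>c''\<close>. The first
  factor is bounded below once \<open>x\<close> is at least a multiple of \<open>\<surd>s\<close>, and smaller \<open>x\<close> follow by monotonicity.

  The far lower bound comes from one summand: \<open>X \<ge> x\<close> as soon as \<open>u i * Z i \<ge> x\<close> and the sum of the others
  is nonnegative. These events are independent. The first has the required probability by the
  assumption on \<open>Z i\<close>, the second has at least constant probability by the central lower bound at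
  \<open>0\<close>, applied to the same family with the weight \<open>u i\<close> replaced by \<open>0\<close>.

  Finally, hypotheses and conclusions depend only on the joint law of \<open>Z 1, \<dots>, Z k\<close>, so constants valid on the
  space \<open>nat \<Rightarrow> real\<close> are valid on every sample space (\<open>mgf_setting_joint_law\<close>).
\<close>

section \<open>Tail bounds from the moment generating function of one variable\<close>

lemma integrable_exp_if_mgf_pos:
  assumes "0 < mgf \<Omega> X t"
  shows "integrable \<Omega> (\<lambda>\<omega>. exp (t * X \<omega>))"
  using assms not_integrable_integral_eq unfolding mgf_def by fastforce

text \<open>The part of the mean of \<open>f\<close> that lies below the level \<open>\<theta> E f\<close> is at most \<open>\<theta> E f\<close>; the rest,
  \<open>E (f \<cdot> 1\<^sub>A)\<close> with \<open>A\<close> the event \<open>\<theta> E f \<le> f\<close>, is controlled by the second moment and the probability of \<open>A\<close> as in the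
  Cauchy--Schwarz inequality.\<close>

lemma (in prob_space) Paley_Zygmund:
  fixes f :: "'a \<Rightarrow> real"
  assumes f: "integrable M f" and f2: "integrable M (\<lambda>\<omega>. (f \<omega>)\<^sup>2)"
    and pos: "0 \<le> expectation f" and \<theta>: "0 \<le> \<theta>" "\<theta> \<le> 1"
  shows "((1 - \<theta>) * expectation f)\<^sup>2
    \<le> expectation (\<lambda>\<omega>. (f \<omega>)\<^sup>2) * prob {\<omega> \<in> space M. \<theta> * expectation f \<le> f \<omega>}"
proof -
  define a where "a = (1 - \<theta>) * expectation f"
  define b where "b = expectation (\<lambda>\<omega>. (f \<omega>)\<^sup>2)"
  define A where "A = {\<omega> \<in> space M. \<theta> * expectation f \<le> f \<omega>}"
  have [measurable]: "f \<in> borel_measurable M" using f by auto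
  have A[measurable]: "A \<in> events" unfolding A_def by measurable
  have ind: "integrable M (indicator A :: 'a \<Rightarrow> real)"
    by (rule integrable_real_indicator) (auto simp: emeasure_finite less_top[symmetric])
  have a0: "0 \<le> a" using pos \<theta> by (simp add: a_def)
  have b0: "0 \<le> b" unfolding b_def by (rule integral_nonneg_AE) auto
  \<comment> \<open>Since \<open>f \<le> f \<cdot> 1\<^sub>A + \<theta> E f\<close> and \<open>2 l f \<cdot> 1\<^sub>A \<le> l\<^sup>2 f\<^sup>2 + 1\<^sub>A\<close>, integration gives a quadratic inequality in \<open>l\<close>.\<close>
  have quad: "2 * l * a \<le> l\<^sup>2 * b + prob A" if l: "0 \<le> l" for l
  proof -
    have pw: "2 * l * (f \<omega> - \<theta> * expectation f) \<le> l\<^sup>2 * (f \<omega>)\<^sup>2 + indicator A \<omega>"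
      if "\<omega> \<in> space M" for \<omega>
    proof (cases "\<omega> \<in> A")
      case True
      have "2 * l * (f \<omega> - \<theta> * expectation f) \<le> 2 * l * f \<omega>"
        using l pos \<theta> by (intro mult_left_mono) auto
      also have "\<dots> \<le> l\<^sup>2 * (f \<omega>)\<^sup>2 + 1"
        using zero_le_power2[of "l * f \<omega> - 1"] by (simp add: power2_eq_square algebra_simps)
      finally show ?thesis using True by simp
    next
      case False
      then have "2 * l * (f \<omega> - \<theta> * expectation f) \<le> 0"
        using l that by (intro mult_nonneg_nonpos) (auto simp: A_def)
      also have "0 \<le> l\<^sup>2 * (f \<omega>)\<^sup>2" by simp
      finally show ?thesis using False by simp
    qed
    have "expectation (\<lambda>\<omega>. 2 * l * (f \<omega> - \<theta> * expectation f))
        \<le> expectation (\<lambda>\<omega>. l\<^sup>2 * (f \<omega>)\<^sup>2 + indicator A \<omega>)"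
      using f f2 ind pw by (intro integral_mono) auto
    moreover have "expectation (\<lambda>\<omega>. f \<omega> - \<theta> * expectation f) = a"
      using f by (simp add: a_def prob_space algebra_simps)
    moreover have "expectation (\<lambda>\<omega>. l\<^sup>2 * (f \<omega>)\<^sup>2 + indicator A \<omega>) = l\<^sup>2 * b + prob A"
      using f2 ind by (simp add: b_def)
    ultimately show ?thesis by simp
  qed
  have "a\<^sup>2 \<le> b * prob A"
  proof (cases "b = 0")
    case True
    have "a = 0"
    proof (rule ccontr)
      assume "a \<noteq> 0"
      then have "a > 0" using a0 by simp
      then have "2 * (1 / a) * a \<le> prob A" using quad[of "1 / a"] True by simp
      then show False using prob_le_1[of A] \<open>a > 0\<close> by simp
    qed
    then show ?thesis using True by simp
  next
    case False
    then have b: "b > 0" using b0 by simp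
    \<comment> \<open>The optimal \<open>l\<close>.\<close>
    have "2 * (a / b) * a \<le> (a / b)\<^sup>2 * b + prob A" using a0 b by (intro quad) simp
    then show ?thesis using b by (simp add: field_simps power2_eq_square)
  qed
  then show ?thesis unfolding a_def b_def A_def .
qed

lemma (in prob_space) tail_le_exp_mgf:
  assumes [measurable]: "X \<in> borel_measurable M" and "0 \<le> t" and "0 < mgf M X t"
  shows "\<P>(\<omega> in M. x \<le> X \<omega>) \<le> mgf M X t * exp (- (t * x))"
proof -
  have "\<P>(\<omega> in M. x \<le> X \<omega>) \<le> \<P>(\<omega> in M. exp (t * x) \<le> exp (t * X \<omega>))"
    using \<open>0 \<le> t\<close> by (intro finite_measure_mono) (auto intro: mult_left_mono)
  also have "\<dots> \<le> mgf M X t / exp (t * x)"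
    unfolding mgf_def
    by (intro integral_Markov_inequality_measure[where A = "{}"] integrable_exp_if_mgf_pos assms) auto
  finally show ?thesis by (simp add: exp_minus field_simps)
qed

text \<open>Paley--Zygmund for \<open>f = exp (t X)\<close> with \<open>\<theta> = exp (- a t\<^sup>2 / 2)\<close>. As \<open>E f \<ge> exp (a t\<^sup>2)\<close>, the event
  \<open>f \<ge> \<theta> E f\<close> forces \<open>t X \<ge> a t\<^sup>2 / 2\<close>; as \<open>E f\<^sup>2 = \<phi>\<^sub>X(2 t)\<close>, the argument \<open>2 t\<close> has to stay in the range of
  the bounds.\<close>

lemma (in prob_space) mgf_sandwich_lower_tail:
  assumes X: "X \<in> borel_measurable M" and t: "0 < t" "2 * t \<le> T" and a: "0 \<le> a"
    and lo: "\<And>t. \<bar>t\<bar> \<le> T \<Longrightarrow> exp (a * t\<^sup>2) \<le> mgf M X t"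
    and up: "\<And>t. \<bar>t\<bar> \<le> T \<Longrightarrow> mgf M X t \<le> exp (b * t\<^sup>2)"
  shows "(1 - exp (- (a * t\<^sup>2 / 2)))\<^sup>2 * exp (- (4 * b * t\<^sup>2)) \<le> \<P>(\<omega> in M. a * t / 2 \<le> X \<omega>)"
proof -
  note [measurable] = X
  define \<theta> where "\<theta> = exp (- (a * t\<^sup>2 / 2))"
  define f where "f \<omega> = exp (t * X \<omega>)" for \<omega>
  have \<theta>: "0 \<le> \<theta>" "\<theta> \<le> 1" using a t by (auto simp: \<theta>_def)
  have f2: "(f \<omega>)\<^sup>2 = exp (2 * t * X \<omega>)" for \<omega>
    by (simp add: f_def power2_eq_square flip: exp_add)
  have Ef: "exp (a * t\<^sup>2) \<le> expectation f"
    using lo[of t] t unfolding mgf_def f_def by simp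
  have Ef2: "expectation (\<lambda>\<omega>. (f \<omega>)\<^sup>2) \<le> exp (4 * b * t\<^sup>2)"
    using up[of "2 * t"] t unfolding mgf_def f2 by (simp add: power_mult_distrib mult_ac)
  have ge1: "1 \<le> expectation f" using Ef a by (intro order_trans[OF _ Ef]) simp
  have pos: "0 < mgf M X s" if "\<bar>s\<bar> \<le> T" for s
    using lo[OF that] by (rule less_le_trans[OF exp_gt_zero])
  have int: "integrable M f" "integrable M (\<lambda>\<omega>. (f \<omega>)\<^sup>2)"
    using t unfolding f2 unfolding f_def by (auto intro!: integrable_exp_if_mgf_pos pos)
  have "(1 - \<theta>)\<^sup>2 \<le> ((1 - \<theta>) * expectation f)\<^sup>2"
    using \<theta> ge1 mult_left_mono[OF ge1, of "1 - \<theta>"] by (intro power_mono) auto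
  also have "\<dots> \<le> expectation (\<lambda>\<omega>. (f \<omega>)\<^sup>2) * \<P>(\<omega> in M. \<theta> * expectation f \<le> f \<omega>)"
    using ge1 by (intro Paley_Zygmund int \<theta>) auto
  also have "\<dots> \<le> exp (4 * b * t\<^sup>2) * \<P>(\<omega> in M. a * t / 2 \<le> X \<omega>)"
  proof (intro mult_mono Ef2 finite_measure_mono)
    show "{\<omega> \<in> space M. \<theta> * expectation f \<le> f \<omega>} \<subseteq> {\<omega> \<in> space M. a * t / 2 \<le> X \<omega>}"
    proof safe
      fix \<omega> assume "\<theta> * expectation f \<le> f \<omega>"
      have "exp (t * (a * t / 2)) = \<theta> * exp (a * t\<^sup>2)"
        by (simp add: \<theta>_def power2_eq_square flip: exp_add)
      also have "\<dots> \<le> \<theta> * expectation f" using Ef \<theta> by (intro mult_left_mono)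
      also have "\<dots> \<le> exp (t * X \<omega>)" using \<open>\<theta> * expectation f \<le> f \<omega>\<close> by (simp add: f_def)
      finally show "a * t / 2 \<le> X \<omega>" using t by simp
    qed
  qed auto
  finally show ?thesis by (simp add: \<theta>_def exp_minus field_simps)
qed

section \<open>The weighted sum\<close>

lemma sup_norm_ge: "i \<in> {1..k} \<Longrightarrow> \<bar>u i\<bar> \<le> sup_norm k u"
  unfolding sup_norm_def by (intro Max_ge) auto

lemma sup_norm_pos: "i \<in> {1..k} \<Longrightarrow> u i \<noteq> 0 \<Longrightarrow> 0 < sup_norm k u"
  using sup_norm_ge[of i k u] by linarith

lemma sup_norm_le_L2_set:
  assumes "1 \<le> k"
  shows "(sup_norm k u)\<^sup>2 \<le> (L2_set u {1..k})\<^sup>2"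
proof -
  have "sup_norm k u \<in> (\<lambda>i. \<bar>u i\<bar>) ` {1..k}"
    unfolding sup_norm_def using assms by (intro Max_in) auto
  then obtain i where "i \<in> {1..k}" "sup_norm k u = \<bar>u i\<bar>" by auto
  then have "(sup_norm k u)\<^sup>2 \<le> (\<Sum>i=1..k. (u i)\<^sup>2)"
    using member_le_sum[of i "{1..k}" "\<lambda>i. (u i)\<^sup>2"] by simp
  then show ?thesis by (simp add: L2_set_def sum_nonneg)
qed

lemma (in prob_space) mgf_weighted_sum:
  assumes ind: "indep_vars (\<lambda>_. borel) Z {1..k}"
    and pos: "\<And>i. i \<in> {1..k} \<Longrightarrow> 0 < mgf M (Z i) (t * u i)"
  shows "mgf M (weighted_sum k u Z) t = (\<Prod>i=1..k. mgf M (Z i) (t * u i))"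
proof -
  have "exp (t * weighted_sum k u Z \<omega>) = (\<Prod>i=1..k. exp (t * u i * Z i \<omega>))" for \<omega>
    by (simp add: weighted_sum_def sum_distrib_left mult.assoc flip: exp_sum)
  moreover have "indep_vars (\<lambda>_. borel) (\<lambda>i \<omega>. exp (t * u i * Z i \<omega>)) {1..k}"
    by (rule indep_vars_compose2[OF ind]) auto
  ultimately show ?thesis
    unfolding mgf_def
    using indep_vars_lebesgue_integral[of "{1..k}" "\<lambda>i \<omega>. exp (t * u i * Z i \<omega>)"]
    by (simp add: integrable_exp_if_mgf_pos pos)
qed

text \<open>All that the tail estimates use of the weighted sum. The bound on the \<open>i\<close>th factor is taken at
  \<open>t * u i\<close>, which is at most \<open>M\<close> in absolute value because \<open>\<bar>t\<bar> \<le> M / sup_norm k u\<close>.\<close>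

lemma mgf_setting_consequences:
  assumes S: "mgf_setting \<Omega> k Z u c1 C1 c'' \<alpha> M"
  defines "s \<equiv> \<alpha> * (L2_set u {1..k})\<^sup>2" and "T \<equiv> M / sup_norm k u"
  shows "weighted_sum k u Z \<in> borel_measurable \<Omega>"
    and "0 < sup_norm k u" and "0 < s" and "0 < T" and "c'' \<le> s * T\<^sup>2" and "c1 \<le> C1"
    and "\<And>t. \<bar>t\<bar> \<le> T \<Longrightarrow> exp (c1 * s * t\<^sup>2) \<le> mgf \<Omega> (weighted_sum k u Z) t"
    and "\<And>t. \<bar>t\<bar> \<le> T \<Longrightarrow> mgf \<Omega> (weighted_sum k u Z) t \<le> exp (C1 * s * t\<^sup>2)"
proof -
  have pos: "0 < \<alpha>" "0 < M" "c'' \<le> \<alpha> * M\<^sup>2"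
    and ind: "prob_space.indep_vars \<Omega> (\<lambda>_. borel) Z {1..k}"
    and lo: "\<And>i t. i \<in> {1..k} \<Longrightarrow> \<bar>t\<bar> \<le> M \<Longrightarrow> exp (c1 * \<alpha> * t\<^sup>2) \<le> mgf \<Omega> (Z i) t"
    and up: "\<And>i t. i \<in> {1..k} \<Longrightarrow> \<bar>t\<bar> \<le> M \<Longrightarrow> mgf \<Omega> (Z i) t \<le> exp (C1 * \<alpha> * t\<^sup>2)"
    using S unfolding mgf_setting_def by auto
  interpret prob_space \<Omega> using S unfolding mgf_setting_def by simp
  obtain i where i: "i \<in> {1..k}" "u i \<noteq> 0" using S unfolding mgf_setting_def by auto
  have [measurable]: "Z j \<in> borel_measurable \<Omega>" if "j \<in> {1..k}" for j
    using ind that by (auto simp: indep_vars_def)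
  show "weighted_sum k u Z \<in> borel_measurable \<Omega>"
    unfolding weighted_sum_def by measurable
  show m: "0 < sup_norm k u" using sup_norm_pos i .
  then show "0 < T" using pos by (simp add: T_def)
  have mL: "(sup_norm k u)\<^sup>2 \<le> (L2_set u {1..k})\<^sup>2" using i by (intro sup_norm_le_L2_set) auto
  then have "0 < (L2_set u {1..k})\<^sup>2" using m by (smt (verit) zero_less_power)
  then show "0 < s" using pos by (simp add: s_def)
  have "c'' \<le> \<alpha> * M\<^sup>2 * 1" using pos by simp
  also have "\<dots> \<le> \<alpha> * M\<^sup>2 * ((L2_set u {1..k})\<^sup>2 / (sup_norm k u)\<^sup>2)"
    using pos mL m by (intro mult_left_mono) auto
  also have "\<dots> = s * T\<^sup>2" by (simp add: s_def T_def power_divide)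
  finally show "c'' \<le> s * T\<^sup>2" .
  have "exp (c1 * \<alpha> * M\<^sup>2) \<le> exp (C1 * \<alpha> * M\<^sup>2)"
    using order_trans[OF lo[OF i(1), of M] up[OF i(1), of M]] pos by simp
  then show "c1 \<le> C1" using pos by simp
  have sum: "(\<Sum>j=1..k. c * \<alpha> * (t * u j)\<^sup>2) = c * s * t\<^sup>2" for c t
    by (simp add: s_def L2_set_def sum_nonneg sum_distrib_left power_mult_distrib mult_ac)
  have tu: "\<bar>t * u j\<bar> \<le> M" if "\<bar>t\<bar> \<le> T" "j \<in> {1..k}" for t j
  proof -
    have "\<bar>t * u j\<bar> \<le> T * sup_norm k u"
      unfolding abs_mult using that sup_norm_ge[of j k u] by (intro mult_mono) auto
    then show ?thesis using m by (simp add: T_def)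
  qed
  have mgfX: "mgf \<Omega> (weighted_sum k u Z) t = (\<Prod>j=1..k. mgf \<Omega> (Z j) (t * u j))" if "\<bar>t\<bar> \<le> T" for t
    using tu[OF that] by (intro mgf_weighted_sum[OF ind] less_le_trans[OF exp_gt_zero lo])
  show "exp (c1 * s * t\<^sup>2) \<le> mgf \<Omega> (weighted_sum k u Z) t" if "\<bar>t\<bar> \<le> T" for t
    unfolding mgfX[OF that] sum[symmetric] exp_sum[OF finite_atLeastAtMost]
    using tu[OF that] by (intro prod_mono) (auto intro: lo)
  show "mgf \<Omega> (weighted_sum k u Z) t \<le> exp (C1 * s * t\<^sup>2)" if "\<bar>t\<bar> \<le> T" for t
    unfolding mgfX[OF that] sum[symmetric] exp_sum[OF finite_atLeastAtMost]
    using tu[OF that] by (intro prod_mono conjI up order_trans[OF exp_ge_zero lo])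
qed

section \<open>The central range\<close>

text \<open>The lower bound is proved at \<open>y\<close>, the maximum of \<open>x\<close> and \<open>c1 / 4 * sqrt (c'' * s)\<close>. The latter still lies
  in the central range because \<open>s * R\<^sup>2 \<ge> c''\<close>. It enters the exponent only through the additive
  constant \<open>C1 * c''\<close>, which becomes the factor \<open>exp (- (C1 * c''))\<close> of \<open>c\<close>, and it keeps the exponent
  \<open>c1 * s * t\<^sup>2 / 2\<close> of the other factor no less than \<open>c1 * c'' / 8\<close>.\<close>

lemma central_tail_bounds_explicit:
  fixes T :: "'a itself"
  assumes c1: "0 < c1" and c'': "0 < c''"
    and c: "c = (1 - exp (- (c1 * c'' / 8)))\<^sup>2 * exp (- (C1 * c''))"
    and c_tilde: "c_tilde \<le> 1 / (4 * C1)"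
  shows "central_tail_bounds T c1 C1 c'' c (c1 / 4) (16 * C1 / c1\<^sup>2) c_tilde"
  unfolding central_tail_bounds_def
proof (intro allI impI)
  fix \<Omega> :: "'a measure" and k Z u \<alpha> M x
  assume S: "mgf_setting \<Omega> k Z u c1 C1 c'' \<alpha> M"
    and x: "0 \<le> x \<and> x \<le> c1 / 4 * M * \<alpha> * (L2_set u {1..k})\<^sup>2 / sup_norm k u"
  define s where "s = \<alpha> * (L2_set u {1..k})\<^sup>2"
  define R where "R = M / sup_norm k u"
  define X where "X = weighted_sum k u Z"
  interpret prob_space \<Omega> using S unfolding mgf_setting_def by simp
  note cons = mgf_setting_consequences[OF S, folded s_def R_def X_def]
  note [measurable] = cons(1)
  have s: "0 < s" and R: "0 < R" and sR: "c'' \<le> s * R\<^sup>2" and C1: "0 < C1"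
    using cons c1 by auto
  have xR: "x \<le> c1 / 4 * s * R" using x by (simp add: s_def R_def mult_ac)
  define y where "y = max x (c1 / 4 * sqrt (c'' * s))"
  have "sqrt (c'' * s) \<le> sqrt ((s * R)\<^sup>2)"
    using mult_right_mono[OF sR, of s] s by (intro real_sqrt_le_mono) (simp add: power2_eq_square mult_ac)
  then have "sqrt (c'' * s) \<le> s * R" using s R by simp
  then have yR: "y \<le> c1 / 4 * s * R" using xR c1 unfolding y_def mult.assoc
    by (intro max.boundedI mult_left_mono) auto
  have y0: "0 < y" using c1 c'' s by (simp add: y_def less_max_iff_disj)
  have y2: "c1\<^sup>2 / 16 * (c'' * s) \<le> y\<^sup>2"
  proof -
    have "(c1 / 4 * sqrt (c'' * s))\<^sup>2 \<le> y\<^sup>2"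
      using c1 c'' s by (intro power_mono) (auto simp: y_def)
    then show ?thesis using c'' s by (simp add: power_mult_distrib power_divide)
  qed
  have y2': "y\<^sup>2 \<le> x\<^sup>2 + c1\<^sup>2 / 16 * (c'' * s)"
    using c'' s by (auto simp: y_def max_def power_mult_distrib power_divide)
  \<comment> \<open>With this \<open>t\<close> the threshold \<open>c1 s t / 2\<close> of the lower bound is \<open>y\<close>.\<close>
  define t where "t = 2 * y / (c1 * s)"
  have t: "0 < t" "2 * t \<le> R" using y0 yR c1 s by (auto simp: t_def field_simps)
  have thr: "c1 * s * t / 2 = y" using c1 s by (simp add: t_def)
  have t2: "t\<^sup>2 = 4 * y\<^sup>2 / (c1\<^sup>2 * s\<^sup>2)" by (simp add: t_def power_mult_distrib power_divide)
  have st2: "s * t\<^sup>2 = 4 / c1\<^sup>2 * (y\<^sup>2 / s)"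
    unfolding t2 using s c1 by (simp add: field_simps power2_eq_square)
  have ys: "c1\<^sup>2 / 16 * c'' \<le> y\<^sup>2 / s" "y\<^sup>2 / s \<le> x\<^sup>2 / s + c1\<^sup>2 / 16 * c''"
    using y2 y2' s by (auto simp: field_simps)
  have e1: "c1 * c'' / 8 \<le> c1 * s * t\<^sup>2 / 2"
    using mult_left_mono[OF ys(1), of "2 / c1"] c1
    by (simp add: mult.assoc st2) (simp add: power2_eq_square mult_ac)
  have e2: "4 * (C1 * s) * t\<^sup>2 \<le> 16 * C1 / c1\<^sup>2 * (x\<^sup>2 / s) + C1 * c''"
  proof -
    have "4 * (C1 * s) * t\<^sup>2 = 16 * C1 / c1\<^sup>2 * (y\<^sup>2 / s)"
      by (simp add: mult.assoc st2)
    also have "\<dots> \<le> 16 * C1 / c1\<^sup>2 * (x\<^sup>2 / s + c1\<^sup>2 / 16 * c'')"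
      using ys C1 by (intro mult_left_mono) auto
    also have "\<dots> = 16 * C1 / c1\<^sup>2 * (x\<^sup>2 / s) + C1 * c''"
      using c1 by (simp add: algebra_simps)
    finally show ?thesis .
  qed
  have "c * exp (- (16 * C1 / c1\<^sup>2) * (x\<^sup>2 / s))
      = (1 - exp (- (c1 * c'' / 8)))\<^sup>2 * exp (- (16 * C1 / c1\<^sup>2 * (x\<^sup>2 / s) + C1 * c''))"
    unfolding c mult.assoc exp_add[symmetric] by (intro arg_cong2[where f = "(*)"] arg_cong[where f = exp]) auto
  also have "\<dots> \<le> (1 - exp (- (c1 * s * t\<^sup>2 / 2)))\<^sup>2 * exp (- (4 * (C1 * s) * t\<^sup>2))"
    using e1 e2 c1 c'' by (intro mult_mono power_mono) auto
  also have "\<dots> \<le> \<P>(\<omega> in \<Omega>. c1 * s * t / 2 \<le> X \<omega>)"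
    using t c1 s cons(7,8) by (intro mgf_sandwich_lower_tail[where T = R]) auto
  also have "\<dots> \<le> \<P>(\<omega> in \<Omega>. x \<le> X \<omega>)"
    unfolding thr by (intro finite_measure_mono) (auto simp: y_def)
  finally have lower: "c * exp (- (16 * C1 / c1\<^sup>2) * (x\<^sup>2 / s)) \<le> \<P>(\<omega> in \<Omega>. x \<le> X \<omega>)" .

  \<comment> \<open>The minimiser of \<open>C1 s r\<^sup>2 - r x\<close>.\<close>
  define r where "r = x / (2 * C1 * s)"
  have r0: "0 \<le> r" using x C1 s by (simp add: r_def)
  have "c1 / 4 * (s * R) \<le> 2 * C1 * (s * R)"
    using cons(6) C1 s R by (intro mult_right_mono) auto
  then have "x \<le> 2 * C1 * s * R" using xR by (simp add: mult.assoc)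
  then have rR: "r \<le> R" using C1 s by (simp add: r_def field_simps)
  have "\<P>(\<omega> in \<Omega>. x \<le> X \<omega>) \<le> mgf \<Omega> X r * exp (- (r * x))"
    using r0 rR by (intro tail_le_exp_mgf less_le_trans[OF exp_gt_zero cons(7)]) auto
  also have "\<dots> \<le> exp (C1 * s * r\<^sup>2) * exp (- (r * x))"
    using r0 rR by (intro mult_right_mono cons(8)) auto
  also have "\<dots> = exp (- (1 / (4 * C1) * (x\<^sup>2 / s)))"
    using C1 s unfolding exp_add[symmetric] r_def by (simp add: field_simps power2_eq_square)
  also have "\<dots> \<le> exp (- c_tilde * (x\<^sup>2 / s))"
    using mult_right_mono[OF c_tilde, of "x\<^sup>2 / s"] s by simp
  finally show "c * exp (- (16 * C1 / c1\<^sup>2) * (x\<^sup>2 / (\<alpha> * (L2_set u {1..k})\<^sup>2))) \<le> \<P>(\<omega> in \<Omega>. weighted_sum k u Z \<omega> \<ge> x) \<and>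
    \<P>(\<omega> in \<Omega>. weighted_sum k u Z \<omega> \<ge> x) \<le> exp (- c_tilde * (x\<^sup>2 / (\<alpha> * (L2_set u {1..k})\<^sup>2)))"
    using lower unfolding s_def X_def by simp
qed

section \<open>The far range\<close>

lemma (in prob_space) prob_add_ge_indep_summand:
  fixes Y W :: "'a \<Rightarrow> real"
  assumes ind: "indep_var borel Y borel W"
  shows "\<P>(\<omega> in M. x \<le> Y \<omega>) * \<P>(\<omega> in M. 0 \<le> W \<omega>) \<le> \<P>(\<omega> in M. x \<le> Y \<omega> + W \<omega>)"
proof -
  have [measurable]: "Y \<in> borel_measurable M" "W \<in> borel_measurable M"
    using ind by (auto dest: indep_var_rv1 indep_var_rv2)
  have "\<P>(\<omega> in M. x \<le> Y \<omega>) * \<P>(\<omega> in M. 0 \<le> W \<omega>)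
      = prob (Y -` {x..} \<inter> space M) * prob (W -` {0..} \<inter> space M)"
    by (intro arg_cong2[where f = "(*)"] arg_cong[where f = prob]) auto
  also have "\<dots> = prob ((\<lambda>\<omega>. (Y \<omega>, W \<omega>)) -` ({x..} \<times> {0..}) \<inter> space M)"
    by (rule indep_varD[OF ind, symmetric]) auto
  also have "\<dots> \<le> \<P>(\<omega> in M. x \<le> Y \<omega> + W \<omega>)"
    by (intro finite_measure_mono) auto
  finally show ?thesis .
qed

text \<open>The central lower bound at \<open>0\<close> for the weights \<open>u(i := 0)\<close>. If these all vanish, the remaining sum is
  \<open>0\<close> and the probability is \<open>1\<close>, whence the minimum.\<close>

lemma prob_remaining_sum_nonneg:
  fixes \<Omega> :: "'a measure"
  assumes S: "mgf_setting \<Omega> k Z u c1 C1 c'' \<alpha> M"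
    and central: "central_tail_bounds TYPE('a) c1 C1 c'' c c' C c_tilde" and c': "0 < c'"
  shows "min c 1 \<le> \<P>(\<omega> in \<Omega>. 0 \<le> (\<Sum>j\<in>{1..k} - {i}. u j * Z j \<omega>))"
proof -
  interpret prob_space \<Omega> using S unfolding mgf_setting_def by simp
  define v where "v = u(i := 0)"
  have W: "weighted_sum k v Z \<omega> = (\<Sum>j\<in>{1..k} - {i}. u j * Z j \<omega>)" for \<omega>
    unfolding weighted_sum_def v_def by (rule sum.mono_neutral_cong_right) auto
  show ?thesis
  proof (cases "\<exists>j\<in>{1..k}. v j \<noteq> 0")
    case True
    then have S': "mgf_setting \<Omega> k Z v c1 C1 c'' \<alpha> M"
      using S unfolding mgf_setting_def by (auto simp: v_def)
    have "0 \<le> c' * M * \<alpha> * (L2_set v {1..k})\<^sup>2 / sup_norm k v"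
      using S' c' mgf_setting_consequences(2)[OF S'] unfolding mgf_setting_def by auto
    then have "c * exp (- C * (0\<^sup>2 / (\<alpha> * (L2_set v {1..k})\<^sup>2))) \<le> \<P>(\<omega> in \<Omega>. weighted_sum k v Z \<omega> \<ge> 0)"
      using central S' unfolding central_tail_bounds_def by blast
    then show ?thesis by (simp add: W)
  next
    case False
    then have "\<And>\<omega>. weighted_sum k v Z \<omega> = 0" unfolding weighted_sum_def by simp
    then show ?thesis unfolding W[symmetric] by (simp add: prob_space)
  qed
qed

lemma far_upper_tail:
  assumes S: "mgf_setting \<Omega> k Z u c1 C1 c'' \<alpha> M"
    and c1: "0 < c1"
    and x: "c1 / 4 * M * \<alpha> * (L2_set u {1..k})\<^sup>2 / sup_norm k u \<le> x"
    and c_tilde: "c_tilde \<le> c1 / (16 * C1)"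
  shows "\<P>(\<omega> in \<Omega>. weighted_sum k u Z \<omega> \<ge> x) \<le> exp (- c_tilde * (M * x / sup_norm k u))"
proof -
  define s where "s = \<alpha> * (L2_set u {1..k})\<^sup>2"
  define R where "R = M / sup_norm k u"
  define X where "X = weighted_sum k u Z"
  interpret prob_space \<Omega> using S unfolding mgf_setting_def by simp
  note cons = mgf_setting_consequences[OF S, folded s_def R_def X_def]
  note [measurable] = cons(1)
  have s: "0 < s" and R: "0 < R" and C1: "0 < C1" "c1 \<le> C1"
    using cons c1 by auto
  have xR: "c1 / 4 * s * R \<le> x" using x by (simp add: s_def R_def mult_ac)
  then have x0: "0 \<le> x" using c1 s R by (smt (verit) divide_pos_pos mult_pos_pos)
  \<comment> \<open>This fraction \<open>h\<close> of the admissible range makes the quadratic term at most half of the linear term.\<close>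
  define h where "h = c1 / (8 * C1)"
  have h: "0 < h" "h \<le> 1" using c1 C1 by (auto simp: h_def)
  have hR: "0 \<le> h * R" "h * R \<le> R" using h R by (auto simp: mult_left_le_one_le)
  have "\<P>(\<omega> in \<Omega>. x \<le> X \<omega>) \<le> mgf \<Omega> X (h * R) * exp (- (h * R * x))"
    using hR by (intro tail_le_exp_mgf less_le_trans[OF exp_gt_zero cons(7)]) auto
  also have "\<dots> \<le> exp (C1 * s * (h * R)\<^sup>2) * exp (- (h * R * x))"
    using hR by (intro mult_right_mono cons(8)) auto
  also have "\<dots> \<le> exp (- (c_tilde * (R * x)))"
  proof -
    have "C1 * s * (h * R)\<^sup>2 = c1 / (16 * C1) * R * (c1 / 4 * s * R)"
      using C1 by (simp add: h_def power2_eq_square field_simps)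
    also have "\<dots> \<le> c1 / (16 * C1) * R * x"
      using xR C1 c1 R by (intro mult_left_mono) auto
    finally have "C1 * s * (h * R)\<^sup>2 - h * R * x \<le> - (c1 / (16 * C1) * (R * x))"
      by (simp add: h_def algebra_simps)
    also have "\<dots> \<le> - (c_tilde * (R * x))"
      using mult_right_mono[OF c_tilde, of "R * x"] R x0 by simp
    finally show ?thesis by (simp flip: exp_add)
  qed
  finally show ?thesis by (simp add: X_def R_def)
qed

text \<open>The tail hypothesis on \<open>Z i\<close> starts at \<open>2 * c' * M * \<alpha>\<close>, whereas \<open>x / u i\<close> may be smaller. Raising the level
  to the larger of the two costs only a constant in the exponent, as \<open>c' * M * \<alpha> \<le> x / sup_norm k u\<close>
  in the far range; this is the \<open>2\<close> in \<open>2 + 1 / c2\<close>.\<close>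

lemma far_tail_bounds_from_central:
  assumes c1: "0 < c1" and c': "c' = c1 / 4"
    and central: "central_tail_bounds TYPE('a) c1 C1 c'' c c' C c_tilde"
    and c_tilde: "c_tilde \<le> c1 / (16 * C1)"
    and c0: "0 < c0" and C0: "0 < C0" and c2: "0 < c2" and c: "0 < c"
  shows "far_tail_bounds TYPE('a) c1 C1 c'' c' c_tilde c0 C0 c2 (c0 * min c 1) (C0 * (2 + 1 / c2))"
  unfolding far_tail_bounds_def
proof (intro allI impI conjI, elim conjE bexE)
  fix \<Omega> :: "'a measure" and k Z u \<alpha> M x i
  assume S: "mgf_setting \<Omega> k Z u c1 C1 c'' \<alpha> M"
    and x: "c' * M * \<alpha> * (L2_set u {1..k})\<^sup>2 / sup_norm k u \<le> x"
    and i: "i \<in> {1..k}"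
    and tail: "\<forall>x. 2 * c' * M * \<alpha> \<le> x \<longrightarrow> c0 * exp (- C0 * M * x) \<le> \<P>(\<omega> in \<Omega>. Z i \<omega> \<ge> x)"
    and ui: "c2 * sup_norm k u \<le> u i"
  interpret prob_space \<Omega> using S unfolding mgf_setting_def by simp
  have \<alpha>: "0 < \<alpha>" and M: "0 < M"
    and ind: "indep_vars (\<lambda>_. borel) Z {1..k}"
    using S unfolding mgf_setting_def by auto
  define m where "m = sup_norm k u"
  have m: "0 < m" using mgf_setting_consequences(2)[OF S] by (simp add: m_def)
  have ui0: "0 < u i" using ui m c2 by (smt (verit) m_def mult_pos_pos)
  have "c' * M * \<alpha> * m\<^sup>2 \<le> c' * M * \<alpha> * (L2_set u {1..k})\<^sup>2"
    using sup_norm_le_L2_set[of k u] i c1 c' M \<alpha> by (intro mult_left_mono) (auto simp: m_def)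
  also have "\<dots> \<le> x * m" using x m by (simp add: m_def pos_divide_le_eq)
  finally have xm: "c' * M * \<alpha> \<le> x / m" using m by (simp add: field_simps power2_eq_square)
  then have x0: "0 \<le> x" using m c1 c' M \<alpha>
    by (smt (verit) divide_neg_pos mult_pos_pos divide_pos_pos)
  \<comment> \<open>A level at which the tail hypothesis applies and which forces \<open>u i * Z i \<ge> x\<close>.\<close>
  define z where "z = max (2 * c' * M * \<alpha>) (x / u i)"
  have "x / u i \<le> x / (c2 * m)" using ui x0 m c2 by (intro divide_left_mono) (auto simp: m_def ui0)
  moreover have "0 \<le> x / (c2 * m)" "0 \<le> x / m" using x0 m c2 by auto
  moreover have "(2 + 1 / c2) * (x / m) = 2 * (x / m) + x / (c2 * m)"
    by (simp add: distrib_right add_divide_distrib)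
  ultimately have z: "z \<le> (2 + 1 / c2) * (x / m)"
    using xm unfolding z_def by linarith
  have ind': "indep_var borel (\<lambda>\<omega>. u i * Z i \<omega>) borel (\<lambda>\<omega>. \<Sum>j\<in>{1..k} - {i}. u j * Z j \<omega>)"
  proof (rule indep_vars_sum)
    have "insert i ({1..k} - {i}) = {1..k}" using i by auto
    then show "indep_vars (\<lambda>_. borel) (\<lambda>j \<omega>. u j * Z j \<omega>) (insert i ({1..k} - {i}))"
      using indep_vars_compose2[OF ind, where Y = "\<lambda>j z. u j * z" and N = "\<lambda>_. borel"] by simp
  qed auto
  have [measurable]: "Z i \<in> borel_measurable \<Omega>" using ind i by (auto simp: indep_vars_def)
  have "c0 * exp (- (C0 * (2 + 1 / c2)) * (M * x / m)) \<le> c0 * exp (- C0 * M * z)"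
    using c0 C0 M mult_left_mono[OF z, of "C0 * M"] by (simp add: mult_ac)
  also have "\<dots> \<le> \<P>(\<omega> in \<Omega>. Z i \<omega> \<ge> z)" using tail[rule_format, of z] by (simp add: z_def)
  also have "\<dots> \<le> \<P>(\<omega> in \<Omega>. u i * Z i \<omega> \<ge> x)"
    using ui0 by (intro finite_measure_mono) (auto simp: z_def field_simps)
  finally have Zi: "c0 * exp (- (C0 * (2 + 1 / c2)) * (M * x / m)) \<le> \<P>(\<omega> in \<Omega>. u i * Z i \<omega> \<ge> x)" .
  have "c0 * min c 1 * exp (- (C0 * (2 + 1 / c2)) * (M * x / m))
      = c0 * exp (- (C0 * (2 + 1 / c2)) * (M * x / m)) * min c 1" by simp
  also have "\<dots> \<le> \<P>(\<omega> in \<Omega>. x \<le> u i * Z i \<omega>) * \<P>(\<omega> in \<Omega>. 0 \<le> (\<Sum>j\<in>{1..k} - {i}. u j * Z j \<omega>))"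
    using Zi c c1 by (intro mult_mono prob_remaining_sum_nonneg[OF S central]) (auto simp: c')
  also have "\<dots> \<le> \<P>(\<omega> in \<Omega>. x \<le> u i * Z i \<omega> + (\<Sum>j\<in>{1..k} - {i}. u j * Z j \<omega>))"
    by (rule prob_add_ge_indep_summand[OF ind'])
  also have "\<dots> = \<P>(\<omega> in \<Omega>. weighted_sum k u Z \<omega> \<ge> x)"
    using i by (simp add: weighted_sum_def sum.remove[of "{1..k}" i, OF _ i] del: One_nat_def)
  finally show "c0 * min c 1 * exp (- (C0 * (2 + 1 / c2)) * (M * x / sup_norm k u))
      \<le> \<P>(\<omega> in \<Omega>. weighted_sum k u Z \<omega> \<ge> x)" by (simp add: m_def)
next
  fix \<Omega> :: "'a measure" and k Z u \<alpha> M x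
  assume "mgf_setting \<Omega> k Z u c1 C1 c'' \<alpha> M \<and>
      (\<exists>i\<in>{1..k}. (\<forall>x. 2 * c' * M * \<alpha> \<le> x \<longrightarrow> c0 * exp (- C0 * M * x) \<le> \<P>(\<omega> in \<Omega>. Z i \<omega> \<ge> x)) \<and>
         c2 * sup_norm k u \<le> u i)"
    and "c' * M * \<alpha> * (L2_set u {1..k})\<^sup>2 / sup_norm k u \<le> x"
  then show "\<P>(\<omega> in \<Omega>. weighted_sum k u Z \<omega> \<ge> x) \<le> exp (- c_tilde * (M * x / sup_norm k u))"
    using far_upper_tail[of \<Omega> k Z u c1 C1 c'' \<alpha> M x c_tilde] c1 c_tilde c' by blast
qed

section \<open>Independence of the sample space\<close>

text \<open>The space is \<open>nat \<Rightarrow> real\<close> with the joint law of \<open>Z 1, \<dots>, Z k\<close>, and the variables are its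
  coordinates. They are independent because the joint law is the product of the marginals.\<close>

lemma mgf_setting_joint_law:
  fixes \<Omega> :: "'a measure"
  assumes S: "mgf_setting \<Omega> k Z u c1 C1 c'' \<alpha> M"
  obtains \<Omega>' :: "(nat \<Rightarrow> real) measure" where
    "mgf_setting \<Omega>' k (\<lambda>i f. f i) u c1 C1 c'' \<alpha> M"
    and "\<And>i x. i \<in> {1..k} \<Longrightarrow> \<P>(f in \<Omega>'. f i \<ge> x) = \<P>(\<omega> in \<Omega>. Z i \<omega> \<ge> x)"
    and "\<And>x. \<P>(f in \<Omega>'. weighted_sum k u (\<lambda>i f. f i) f \<ge> x) = \<P>(\<omega> in \<Omega>. weighted_sum k u Z \<omega> \<ge> x)"
proof -
  interpret prob_space \<Omega> using S unfolding mgf_setting_def by simp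
  define I where "I = {1..k}"
  have ind: "indep_vars (\<lambda>_. borel) Z I" using S unfolding mgf_setting_def I_def by simp
  have I: "I \<noteq> {}" using S unfolding mgf_setting_def I_def by auto
  have Z[measurable]: "Z i \<in> borel_measurable \<Omega>" if "i \<in> I" for i
    using ind that by (auto simp: indep_vars_def)
  define F where "F = (\<lambda>\<omega>. \<lambda>i\<in>I. Z i \<omega>)"
  define P where "P = (\<Pi>\<^sub>M i\<in>I. (borel :: real measure))"
  define \<Omega>' where "\<Omega>' = distr \<Omega> P F"
  have F[measurable]: "F \<in> measurable \<Omega> P" unfolding F_def P_def by measurable
  have proj[measurable]: "(\<lambda>f. f i) \<in> borel_measurable P" if "i \<in> I" for i
    using that unfolding P_def by measurable
  have FZ: "F \<omega> i = Z i \<omega>" if "i \<in> I" for i \<omega> using that by (simp add: F_def)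
  interpret \<Omega>': prob_space \<Omega>' unfolding \<Omega>'_def by (rule prob_space_distr) (rule F)
  have proj': "(\<lambda>f. f i) \<in> borel_measurable \<Omega>'" if "i \<in> I" for i
    using proj[OF that] by (simp add: \<Omega>'_def)
  have "distr \<Omega>' P (\<lambda>f. \<lambda>i\<in>I. f i) = distr \<Omega> P ((\<lambda>f. \<lambda>i\<in>I. f i) \<circ> F)"
    unfolding \<Omega>'_def by (rule distr_distr) (auto simp: P_def F_def)
  also have "(\<lambda>f. \<lambda>i\<in>I. f i) \<circ> F = F" by (auto simp: F_def)
  also have "distr \<Omega> P F = (\<Pi>\<^sub>M i\<in>I. distr \<Omega> borel (Z i))"
    using indep_vars_iff_distr_eq_PiM'[OF I, where M' = "\<lambda>_. borel" and X = Z] ind Z unfolding P_def F_def by simp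
  also have "\<dots> = (\<Pi>\<^sub>M i\<in>I. distr \<Omega>' borel (\<lambda>f. f i))"
    unfolding \<Omega>'_def
    by (intro PiM_cong refl) (auto simp: distr_distr FZ intro!: distr_cong)
  finally have ind': "\<Omega>'.indep_vars (\<lambda>_. borel) (\<lambda>i f. f i) I"
    using \<Omega>'.indep_vars_iff_distr_eq_PiM'[OF I, where M' = "\<lambda>_. borel" and X = "\<lambda>i f. f i"] proj'
    unfolding P_def by blast
  have cent: "centered \<Omega>' (\<lambda>f. f i) = centered \<Omega> (Z i)" if "i \<in> I" for i
    unfolding centered_def \<Omega>'_def using proj[OF that] that
    by (simp add: integrable_distr_eq integral_distr FZ)
  have mgf': "mgf \<Omega>' (\<lambda>f. f i) t = mgf \<Omega> (Z i) t" if "i \<in> I" for i t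
    unfolding mgf_def \<Omega>'_def using proj[OF that] that by (simp add: integral_distr FZ)
  have pr: "\<P>(f in \<Omega>'. g f \<ge> x) = \<P>(\<omega> in \<Omega>. g (F \<omega>) \<ge> x)" if g: "g \<in> borel_measurable P" for g and x :: real
  proof -
    have "{f \<in> space P. g f \<ge> x} \<in> sets P" using g by measurable
    then have "\<P>(f in \<Omega>'. g f \<ge> x) = prob (F -` {f \<in> space P. g f \<ge> x} \<inter> space \<Omega>)"
      unfolding \<Omega>'_def by (simp add: measure_distr)
    also have "F -` {f \<in> space P. g f \<ge> x} \<inter> space \<Omega> = {\<omega> \<in> space \<Omega>. g (F \<omega>) \<ge> x}"
      using measurable_space[OF F] by auto
    finally show ?thesis .
  qed
  show thesis
  proof (rule that[of \<Omega>'])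
    show "mgf_setting \<Omega>' k (\<lambda>i f. f i) u c1 C1 c'' \<alpha> M"
      using S ind' cent mgf' \<Omega>'.prob_space_axioms unfolding mgf_setting_def I_def by simp
    show "\<P>(f in \<Omega>'. f i \<ge> x) = \<P>(\<omega> in \<Omega>. Z i \<omega> \<ge> x)" if "i \<in> {1..k}" for i x
      using pr[of "\<lambda>f. f i" x] that by (simp add: FZ I_def)
    have "weighted_sum k u (\<lambda>i f. f i) \<in> borel_measurable P"
      unfolding weighted_sum_def I_def[symmetric] by measurable
    then show "\<P>(f in \<Omega>'. weighted_sum k u (\<lambda>i f. f i) f \<ge> x) = \<P>(\<omega> in \<Omega>. weighted_sum k u Z \<omega> \<ge> x)" for x
      using pr by (simp add: weighted_sum_def FZ I_def)
  qed
qed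

lemma central_tail_bounds_any_sample_space:
  assumes "central_tail_bounds TYPE(nat \<Rightarrow> real) c1 C1 c'' c c' C c_tilde"
  shows "central_tail_bounds TYPE('a) c1 C1 c'' c c' C c_tilde"
  unfolding central_tail_bounds_def
proof (intro allI impI)
  fix \<Omega> :: "'a measure" and k Z u \<alpha> M x
  assume S: "mgf_setting \<Omega> k Z u c1 C1 c'' \<alpha> M"
    and x: "0 \<le> x \<and> x \<le> c' * M * \<alpha> * (L2_set u {1..k})\<^sup>2 / sup_norm k u"
  obtain \<Omega>' :: "(nat \<Rightarrow> real) measure" where
    S': "mgf_setting \<Omega>' k (\<lambda>i f. f i) u c1 C1 c'' \<alpha> M"
    and "\<And>i x. i \<in> {1..k} \<Longrightarrow> \<P>(f in \<Omega>'. f i \<ge> x) = \<P>(\<omega> in \<Omega>. Z i \<omega> \<ge> x)"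
    and pr: "\<And>x. \<P>(f in \<Omega>'. weighted_sum k u (\<lambda>i f. f i) f \<ge> x) = \<P>(\<omega> in \<Omega>. weighted_sum k u Z \<omega> \<ge> x)"
    by (rule mgf_setting_joint_law[OF S]) (rule that)
  show "c * exp (- C * (x\<^sup>2 / (\<alpha> * (L2_set u {1..k})\<^sup>2))) \<le> \<P>(\<omega> in \<Omega>. weighted_sum k u Z \<omega> \<ge> x) \<and>
      \<P>(\<omega> in \<Omega>. weighted_sum k u Z \<omega> \<ge> x) \<le> exp (- c_tilde * (x\<^sup>2 / (\<alpha> * (L2_set u {1..k})\<^sup>2)))"
    unfolding pr[symmetric] using assms S' x unfolding central_tail_bounds_def by blast
qed

lemma far_tail_bounds_any_sample_space:
  assumes "far_tail_bounds TYPE(nat \<Rightarrow> real) c1 C1 c'' c' c_tilde c0 C0 c2 c_bar C_bar"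
  shows "far_tail_bounds TYPE('a) c1 C1 c'' c' c_tilde c0 C0 c2 c_bar C_bar"
  unfolding far_tail_bounds_def
proof (intro allI impI, elim conjE bexE)
  fix \<Omega> :: "'a measure" and k Z u \<alpha> M x i
  assume S: "mgf_setting \<Omega> k Z u c1 C1 c'' \<alpha> M" and i: "i \<in> {1..k}"
    and tail: "\<forall>x. 2 * c' * M * \<alpha> \<le> x \<longrightarrow> c0 * exp (- C0 * M * x) \<le> \<P>(\<omega> in \<Omega>. Z i \<omega> \<ge> x)"
    and ui: "c2 * sup_norm k u \<le> u i"
    and x: "c' * M * \<alpha> * (L2_set u {1..k})\<^sup>2 / sup_norm k u \<le> x"
  obtain \<Omega>' :: "(nat \<Rightarrow> real) measure" where
    S': "mgf_setting \<Omega>' k (\<lambda>i f. f i) u c1 C1 c'' \<alpha> M"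
    and Zi: "\<And>i x. i \<in> {1..k} \<Longrightarrow> \<P>(f in \<Omega>'. f i \<ge> x) = \<P>(\<omega> in \<Omega>. Z i \<omega> \<ge> x)"
    and pr: "\<And>x. \<P>(f in \<Omega>'. weighted_sum k u (\<lambda>i f. f i) f \<ge> x) = \<P>(\<omega> in \<Omega>. weighted_sum k u Z \<omega> \<ge> x)"
    by (rule mgf_setting_joint_law[OF S]) (rule that)
  show "c_bar * exp (- C_bar * (M * x / sup_norm k u)) \<le> \<P>(\<omega> in \<Omega>. weighted_sum k u Z \<omega> \<ge> x) \<and>
      \<P>(\<omega> in \<Omega>. weighted_sum k u Z \<omega> \<ge> x) \<le> exp (- c_tilde * (M * x / sup_norm k u))"
    unfolding pr[symmetric]
    using assms S' x i tail[folded Zi[OF i]] ui unfolding far_tail_bounds_def by blast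
qed

theorem theorem4:
  fixes c1 C1 c'' :: real
  assumes "0 < c1" and "0 < C1" and "0 < c''"
  shows
    "(\<exists>c>0. \<exists>c'>0. \<exists>C>0. \<exists>c_tilde>0.
        central_tail_bounds TYPE(nat \<Rightarrow> real) c1 C1 c'' c c' C c_tilde \<and>
        (\<forall>c0>0. \<forall>C0>0. \<forall>c2>0. \<exists>c_bar>0. \<exists>C_bar>0.
           far_tail_bounds TYPE(nat \<Rightarrow> real) c1 C1 c'' c' c_tilde c0 C0 c2 c_bar C_bar)) \<and>
     (\<forall>c>0. \<forall>c'>0. \<forall>C>0. \<forall>c_tilde>0.
        central_tail_bounds TYPE(nat \<Rightarrow> real) c1 C1 c'' c c' C c_tilde \<longrightarrow>
        central_tail_bounds TYPE('a) c1 C1 c'' c c' C c_tilde) \<and>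
     (\<forall>c'>0. \<forall>c_tilde>0. \<forall>c0>0. \<forall>C0>0. \<forall>c2>0. \<forall>c_bar>0. \<forall>C_bar>0.
        far_tail_bounds TYPE(nat \<Rightarrow> real) c1 C1 c'' c' c_tilde c0 C0 c2 c_bar C_bar \<longrightarrow>
        far_tail_bounds TYPE('a) c1 C1 c'' c' c_tilde c0 C0 c2 c_bar C_bar)"
proof (intro conjI)
  define c where "c = (1 - exp (- (c1 * c'' / 8)))\<^sup>2 * exp (- (C1 * c''))"
  define C where "C = 16 * C1 / c1\<^sup>2"
  define c_tilde where "c_tilde = min (1 / (4 * C1)) (c1 / (16 * C1))"
  have pos: "0 < c" "0 < c1 / 4" "0 < C" "0 < c_tilde"
    using assms by (auto simp: c_def C_def c_tilde_def)
  have central: "central_tail_bounds TYPE(nat \<Rightarrow> real) c1 C1 c'' c (c1 / 4) C c_tilde"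
    unfolding C_def using assms by (intro central_tail_bounds_explicit c_def) (auto simp: c_tilde_def)
  have far: "\<exists>c_bar>0. \<exists>C_bar>0.
      far_tail_bounds TYPE(nat \<Rightarrow> real) c1 C1 c'' (c1 / 4) c_tilde c0 C0 c2 c_bar C_bar"
    if "0 < c0" "0 < C0" "0 < c2" for c0 C0 c2
  proof (intro exI conjI)
    show "far_tail_bounds TYPE(nat \<Rightarrow> real) c1 C1 c'' (c1 / 4) c_tilde c0 C0 c2
        (c0 * min c 1) (C0 * (2 + 1 / c2))"
      using assms that pos by (intro far_tail_bounds_from_central[OF _ _ central]) (auto simp: c_tilde_def)
  qed (use that pos in \<open>auto intro!: mult_pos_pos add_pos_pos\<close>)
  show "\<exists>c>0. \<exists>c'>0. \<exists>C>0. \<exists>c_tilde>0.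
        central_tail_bounds TYPE(nat \<Rightarrow> real) c1 C1 c'' c c' C c_tilde \<and>
        (\<forall>c0>0. \<forall>C0>0. \<forall>c2>0. \<exists>c_bar>0. \<exists>C_bar>0.
           far_tail_bounds TYPE(nat \<Rightarrow> real) c1 C1 c'' c' c_tilde c0 C0 c2 c_bar C_bar)"
    by (rule exI[of _ c], rule conjI[OF pos(1)], rule exI[of _ "c1 / 4"], rule conjI[OF pos(2)],
        rule exI[of _ C], rule conjI[OF pos(3)], rule exI[of _ c_tilde], rule conjI[OF pos(4)],
        rule conjI[OF central], intro allI impI, rule far)
qed (intro allI impI, erule central_tail_bounds_any_sample_space,
     intro allI impI, erule far_tail_bounds_any_sample_space)

end
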